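(* Let $X$ be a $\mathbb{Z}^d$ shift with the uniform filling property and let $L\subsetneq\mathbb{Z}^d$ be any $r$-dimensional sublattice ($1\leq r<d$). Then $h_{\mathrm{top}}(X)=h_L(X)$ if and only if $X=(X_L)^{\mathbb{Z}^{d-r}}$.
   Context: For a finite alphabet $\mathcal{A}$ let $\mathcal{A}^{\mathbb{Z}^d}$ carry the product topology and the shift action $(\sigma_{\vec\imath}(x))_{\vec\jmath}=x_{\vec\imath+\vec\jmath}$. A $\mathbb{Z}^d$ shift is a closed $\sigma$-invariant subset $X\subseteq\mathcal{A}^{\mathbb{Z}^d}$ (not assumed to be of finite type). For finite $F\subsetneq\mathbb{Z}^d$ put $\mathcal{L}_F(X)=\{x|_F\mid x\in X\}$. Topological entropy: $h_{\mathrm{top}}(X)=\lim_{n\to\infty}\frac{\log|\mathcal{L}_{C_n}(X)|}{|C_n|}$ with $C_n=\{\vec\imath\in\mathbb{Z}^d\mid\|\vec\imath\|_\infty\le n\}$. A block is a set $[\vec u,\vec v]=\{\vec\imath\in\mathbb{Z}^d\mid\vec u_k\le\vec\imath_k\le\vec v_k\ \forall\,1\le k\le d\}$; $\vec{\mathbb 1}$ denotes the vector with all components equal to $1$. Uniform filling property: there exists a filling length $l\in\mathbb{N}_0$ such that for every point $y\in X$ and every pattern $P\in\mathcal{L}_B(X)$ on some block $B=[\vec u,\vec v]\subsetneq\mathbb{Z}^d$ there exists $x\in X$ with $x|_B=P$ and $x|_{\mathbb{Z}^d\setminus[\vec u-l\vec{\mathbb 1},\vec v+l\vec{\mathbb 1}]}=y|_{\mathbb{Z}^d\setminus[\vec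 u-l\vec{\mathbb 1},\vec v+l\vec{\mathbb 1}]}$. Sublattices: for $1\le r<d$, let $\vec u^{(1)},\dots,\vec u^{(r)},\vec v^{(1)},\dots,\vec v^{(d-r)}\in\mathbb{Z}^d$ be linearly independent with integer span equal to $\mathbb{Z}^d$. Then $L=\langle\vec u^{(1)},\dots,\vec u^{(r)}\rangle_{\mathbb{Z}}$ is called an $r$-dimensional sublattice of $\mathbb{Z}^d$ and $L'=\langle\vec v^{(1)},\dots,\vec v^{(d-r)}\rangle_{\mathbb{Z}}$ a complementary sublattice. $X_L=\{x|_L\mid x\in X\}$ is regarded as a $\mathbb{Z}^r$ shift via the isomorphism $L\cong\mathbb{Z}^r$ given by the generators $\vec u^{(1)},\dots,\vec u^{(r)}$, and the $L$-projectional entropy of $X$ is $h_L(X)=h_{\mathrm{top}}(X_L)$ (entropy as a $\mathbb{Z}^r$ shift). $(X_L)^{\mathbb{Z}^{d-r}}$ is the $\mathbb{Z}^d$ shift of all $x\in\mathcal{A}^{\mathbb{Z}^d}$ such that for every $\vec w\in L'$ the configuration $(x_{\vec u+\vec w})_{\vec u\in L}$ belongs to $X_L$ (this does not depend on the choice of $L'$). *)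

theory Defs
  imports "HOL-Analysis.Analysis"
begin

interpretation int_vec: module "(*s) :: int \<Rightarrow> int ^ 'd \<Rightarrow> int ^ 'd"
  by unfold_locales (simp_all add: vec_eq_iff algebra_simps)

text \<open>The group \<open>\<int>\<^sup>d\<close> is rendered as \<open>int ^ 'd\<close> with \<open>d = CARD('d)\<close>, the alphabet as a finite type with
  its discrete topology. Note that the empty set counts as a shift.\<close>

definition shift_map :: "int ^ 'd \<Rightarrow> (int ^ 'd \<Rightarrow> 'a) \<Rightarrow> (int ^ 'd \<Rightarrow> 'a)" where
  "shift_map i x = (\<lambda>j. x (i + j))"

definition is_shift :: "(int ^ 'd \<Rightarrow> 'a::finite) set \<Rightarrow> bool" where
  "is_shift X \<longleftrightarrow>
     closedin (product_topology (\<lambda>_. discrete_topology UNIV) UNIV) X \<and>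
     (\<forall>i. shift_map i ` X = X)"

text \<open>The restriction \<open>x|\<^sub>F\<close> is \<^term>\<open>restrict x F\<close>, the function that is \<^term>\<open>undefined\<close> outside \<open>F\<close>.
  The set \<open>F\<close> may be infinite, so that this also gives \<open>X\<^sub>L\<close> for a sublattice \<open>L\<close>.\<close>

definition patterns :: "(int ^ 'd) set \<Rightarrow> (int ^ 'd \<Rightarrow> 'a) set \<Rightarrow> (int ^ 'd \<Rightarrow> 'a) set" where
  "patterns F X = (\<lambda>x. restrict x F) ` X"

definition cube :: "nat \<Rightarrow> (int ^ 'd) set" where
  "cube n = {i. \<forall>k. \<bar>i $ k\<bar> \<le> int n}"

text \<open>As \<open>ln 0 = 0\<close>, the empty shift has entropy \<open>0\<close> (in every dimension).\<close>

definition h_top :: "(int ^ 'd \<Rightarrow> 'a::finite) set \<Rightarrow> real" where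
  "h_top X = lim (\<lambda>n. ln (real (card (patterns (cube n) X))) / real (card (cube n :: (int ^ 'd) set)))"

text \<open>The order on \<open>int ^ 'd\<close> is componentwise, so the block \<open>[u, v]\<close> is \<^term>\<open>{u..v}\<close>; it is always a
  proper subset of \<open>\<int>\<^sup>d\<close>.\<close>

definition uniform_filling :: "(int ^ 'd \<Rightarrow> 'a::finite) set \<Rightarrow> bool" where
  "uniform_filling X \<longleftrightarrow>
     (\<exists>l::nat. \<forall>y\<in>X. \<forall>u v. \<forall>P\<in>patterns {u..v} X. \<exists>x\<in>X.
        restrict x {u..v} = P \<and>
        restrict x (- {u - int l *s 1 .. v + int l *s 1})
          = restrict y (- {u - int l *s 1 .. v + int l *s 1}))"

text \<open>The families \<open>u\<close> and \<open>v\<close> together form a basis of \<open>\<int>\<^sup>d\<close>. As types are nonempty, the condition on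
  the cardinalities entails \<open>1 \<le> r < d\<close> for \<open>r = CARD('r)\<close>.\<close>

definition complementary_generators ::
    "('r::finite \<Rightarrow> int ^ 'd) \<Rightarrow> ('s::finite \<Rightarrow> int ^ 'd) \<Rightarrow> bool" where
  "complementary_generators u v \<longleftrightarrow>
     CARD('r) + CARD('s) = CARD('d) \<and>
     inj (case_sum u v) \<and>
     int_vec.independent (range (case_sum u v)) \<and>
     int_vec.span (range (case_sum u v)) = UNIV"

definition lattice_point :: "('r::finite \<Rightarrow> int ^ 'd) \<Rightarrow> int ^ 'r \<Rightarrow> int ^ 'd" where
  "lattice_point u m = (\<Sum>i\<in>UNIV. m $ i *s u i)"

text \<open>\<open>X\<^sub>L\<close> for \<open>L = \<langle>u\<rangle>\<close>, transported to \<open>\<int>\<^sup>r\<close> along the isomorphism given by \<open>u\<close>.\<close>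

definition projection_shift ::
    "('r::finite \<Rightarrow> int ^ 'd) \<Rightarrow> (int ^ 'd \<Rightarrow> 'a) set \<Rightarrow> (int ^ 'r \<Rightarrow> 'a) set" where
  "projection_shift u X =
     (\<lambda>z m. z (lattice_point u m)) ` patterns (int_vec.span (range u)) X"

definition projectional_entropy ::
    "('r::finite \<Rightarrow> int ^ 'd) \<Rightarrow> (int ^ 'd \<Rightarrow> 'a::finite) set \<Rightarrow> real" where
  "projectional_entropy u X = h_top (projection_shift u X)"

text \<open>For \<open>Y\<close> a set of configurations on \<open>L\<close> and \<open>L'\<close> complementary to \<open>L\<close>, this is \<open>Y\<close> raised to the
  power \<open>\<int>\<^bsup>d-r\<^esup>\<close>.\<close>

definition lattice_power ::
    "(int ^ 'd) set \<Rightarrow> (int ^ 'd) set \<Rightarrow> (int ^ 'd \<Rightarrow> 'a) set \<Rightarrow> (int ^ 'd \<Rightarrow> 'a) set" where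
  "lattice_power L L' Y = {x. \<forall>w\<in>L'. (\<lambda>u\<in>L. x (u + w)) \<in> Y}"

end

theory Submission
  imports Defs
begin

text \<open>
  \<open>X\<close> is contained in \<open>Y = lattice_power L L' X\<^sub>L\<close>. On a box in the coordinates given by \<open>L\<close> and \<open>L'\<close> the patterns of \<open>Y\<close> are
  independent choices of patterns of \<open>X\<^sub>L\<close>, and entropy may be computed along such skew boxes instead of cubes
  since both are Folner sequences of tiles; hence \<open>Y\<close> has entropy \<open>h\<^sub>L(X)\<close>. Filling slice by slice, \<open>Y\<close> inherits
  the uniform filling property. If \<open>X \<noteq> Y\<close>, some pattern of \<open>Y\<close> on a cube is missing from \<open>X\<close>; as it can be
  inserted independently at a set of positions of positive density, avoiding it costs a positive amount of
  entropy, so \<open>h(X) < h(Y)\<close>.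
\<close>

text \<open>For general Folner sequences, convergence of subadditive set functions is the
  Ornstein-Weiss lemma. Tiling reduces it to counting tiles and still covers both families needed:
  cubes, and images of products of cubes under the change of basis. The latter are needed because a
  cube of Z^d generally meets the cosets of L in sets that are not cubes in the coordinates
  \<open>u\<close>, so its patterns do not split into equal independent factors. The same mismatch
  shapes the filling argument. A block of Z^d generally cuts a coset of L in a set that is no block
  in the coordinates \<open>u\<close>, so filling is not sought in the projection. Each slice is
  lifted to a point of \<open>X\<close>, filled there with a d-dimensional block, and only then
  restricted to L. The cost in entropy comes from a bounded-to-one surgery. Inserting the missing
  pattern changes symbols only inside a translate of \<open>cube K\<close>, so with A the alphabet
  and a = |A|^|cube K|, at most a patterns become equal. Forbidding one more position thus
  multiplies the count by at most r = 1 - 1/a, and h(X) <= h(Y) + ln r / |cube K|.\<close>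

section \<open>Subadditive set functions along Folner sequences of tiles\<close>

definition tiles :: "'g::ab_group_add set \<Rightarrow> bool" where
  "tiles T \<longleftrightarrow> (\<exists>S. \<forall>z. \<exists>!s. s \<in> S \<and> z - s \<in> T)"

text \<open>Growth of sumsets replaces the usual symmetric differences, since this ratio directly
  bounds the number of tiles meeting \<open>F n\<close>. For \<open>E = {}\<close> the ratio would
  be 0.\<close>

definition folner :: "(nat \<Rightarrow> 'g::ab_group_add set) \<Rightarrow> bool" where
  "folner F \<longleftrightarrow> (\<forall>n. finite (F n) \<and> F n \<noteq> {}) \<and>
     (\<forall>E. finite E \<and> E \<noteq> {} \<longrightarrow> (\<lambda>n. real (card (E + F n)) / real (card (F n))) \<longlonglongrightarrow> 1)"

lemma card_le_card_set_plus:
  fixes E F :: "'g::ab_group_add set"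
  assumes "finite E" "E \<noteq> {}" "finite F"
  shows "card F \<le> card (E + F)"
proof -
  obtain e where "e \<in> E" using assms by auto
  then have "(+) e ` F \<subseteq> E + F" by auto
  then have "card ((+) e ` F) \<le> card (E + F)"
    by (intro card_mono finite_set_plus assms)
  then show ?thesis by (simp add: card_image)
qed

text \<open>\<open>E\<close> need not be a product, but it lies in the product of its two
  projections, for which the ratio factors.\<close>

lemma folner_Times:
  fixes F :: "nat \<Rightarrow> 'g::ab_group_add set" and G :: "nat \<Rightarrow> 'h::ab_group_add set"
  assumes "folner F" "folner G"
  shows "folner (\<lambda>n. F n \<times> G n)"
  unfolding folner_def
proof (intro conjI allI impI)
  fix n show "finite (F n \<times> G n)" "F n \<times> G n \<noteq> {}"
    using assms by (auto simp: folner_def)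
next
  fix E :: "('g \<times> 'h) set" assume E: "finite E \<and> E \<noteq> {}"
  have fin: "finite (F n)" "F n \<noteq> {}" "finite (G n)" "G n \<noteq> {}" for n
    using assms by (auto simp: folner_def)
  let ?f = "\<lambda>n. (real (card (fst ` E + F n)) / real (card (F n))) *
                (real (card (snd ` E + G n)) / real (card (G n)))"
  have lim: "?f \<longlonglongrightarrow> 1 * 1"
    using assms E by (intro tendsto_mult) (auto simp: folner_def)
  have "1 \<le> real (card (E + F n \<times> G n)) / real (card (F n \<times> G n))" for n
  proof -
    have "card (F n \<times> G n) \<le> card (E + F n \<times> G n)" "0 < card (F n \<times> G n)"
      using card_le_card_set_plus[of E "F n \<times> G n"] E fin[of n] by (auto simp: card_gt_0_iff)
    then show ?thesis by (simp add: le_divide_eq del: card_cartesian_product)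
  qed
  moreover have "real (card (E + F n \<times> G n)) / real (card (F n \<times> G n)) \<le> ?f n" for n
  proof -
    have "E + F n \<times> G n \<subseteq> (fst ` E + F n) \<times> (snd ` E + G n)"
      by (force simp: set_plus_def)
    then have "card (E + F n \<times> G n) \<le> card ((fst ` E + F n) \<times> (snd ` E + G n))"
      using E fin by (intro card_mono finite_cartesian_product finite_set_plus) auto
    then have "real (card (E + F n \<times> G n)) \<le> real (card (fst ` E + F n)) * real (card (snd ` E + G n))"
      unfolding card_cartesian_product of_nat_mult[symmetric] of_nat_le_iff .
    then have "real (card (E + F n \<times> G n)) / real (card (F n \<times> G n)) \<le>
        real (card (fst ` E + F n)) * real (card (snd ` E + G n)) / real (card (F n \<times> G n))"
      by (rule divide_right_mono) simp
    then show ?thesis by (simp add: card_cartesian_product)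
  qed
  ultimately show "(\<lambda>n. real (card (E + F n \<times> G n)) / real (card (F n \<times> G n))) \<longlonglongrightarrow> 1"
    by - (rule tendsto_sandwich[OF always_eventually always_eventually tendsto_const lim[unfolded mult_1]];
      simp only: simp_thms)
qed

lemma folner_image:
  fixes F :: "nat \<Rightarrow> 'g::ab_group_add set" and \<phi> :: "'g \<Rightarrow> 'h::ab_group_add"
  assumes "folner F" "bij \<phi>" and add: "\<And>x y. \<phi> (x + y) = \<phi> x + \<phi> y"
  shows "folner (\<lambda>n. \<phi> ` F n)"
  unfolding folner_def
proof (intro conjI allI impI)
  fix n show "finite (\<phi> ` F n)" "\<phi> ` F n \<noteq> {}"
    using assms by (auto simp: folner_def)
next
  fix E :: "'h set" assume E: "finite E \<and> E \<noteq> {}"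
  have inj: "inj_on \<phi> A" for A
    using \<open>bij \<phi>\<close> by (meson bij_is_inj inj_on_subset subset_UNIV)
  define E' where "E' = \<phi> -` E"
  have E': "finite E'" "E' \<noteq> {}" "\<phi> ` E' = E"
  proof -
    show "finite E'" using E inj unfolding E'_def by (blast intro: finite_vimageI)
    show "\<phi> ` E' = E" using bij_is_surj[OF \<open>bij \<phi>\<close>] unfolding E'_def by (rule surj_image_vimage_eq)
    then show "E' \<noteq> {}" using E by auto
  qed
  have "E + \<phi> ` F n = \<phi> ` (E' + F n)" for n
    unfolding E'(3)[symmetric] by (force simp: set_plus_def add)
  then show "(\<lambda>n. real (card (E + \<phi> ` F n)) / real (card (\<phi> ` F n))) \<longlonglongrightarrow> 1"
    using assms(1) E' by (simp add: card_image inj folner_def)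
qed

lemma tiles_Times:
  assumes "tiles S" "tiles T"
  shows "tiles (S \<times> T)"
proof -
  obtain A B where A: "\<And>z. \<exists>!s. s \<in> A \<and> z - s \<in> S" and B: "\<And>z. \<exists>!s. s \<in> B \<and> z - s \<in> T"
    using assms unfolding tiles_def by metis
  have "\<exists>!s. s \<in> A \<times> B \<and> z - s \<in> S \<times> T" for z
  proof -
    obtain a where a: "a \<in> A" "fst z - a \<in> S" "\<And>a'. a' \<in> A \<Longrightarrow> fst z - a' \<in> S \<Longrightarrow> a' = a"
      using A[of "fst z"] by blast
    obtain b where b: "b \<in> B" "snd z - b \<in> T" "\<And>b'. b' \<in> B \<Longrightarrow> snd z - b' \<in> T \<Longrightarrow> b' = b"
      using B[of "snd z"] by blast
    show ?thesis
    proof (rule ex1I)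
      show "(a, b) \<in> A \<times> B \<and> z - (a, b) \<in> S \<times> T"
        using a(1,2) b(1,2) by (simp add: mem_Times_iff)
      fix s assume "s \<in> A \<times> B \<and> z - s \<in> S \<times> T"
      then show "s = (a, b)"
        using a(3)[of "fst s"] b(3)[of "snd s"] by (simp add: mem_Times_iff prod_eq_iff)
    qed
  qed
  then show ?thesis unfolding tiles_def by blast
qed

lemma tiles_image:
  fixes \<phi> :: "'g::ab_group_add \<Rightarrow> 'h::ab_group_add"
  assumes "tiles T" "bij \<phi>" and add: "\<And>x y. \<phi> (x + y) = \<phi> x + \<phi> y"
  shows "tiles (\<phi> ` T)"
proof -
  obtain S where S: "\<And>z. \<exists>!s. s \<in> S \<and> z - s \<in> T"
    using assms(1) unfolding tiles_def by metis
  have inj: "\<phi> x = \<phi> y \<longleftrightarrow> x = y" for x y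
    using \<open>bij \<phi>\<close> by (auto dest: bij_is_inj injD)
  have diff: "\<phi> (x - y) = \<phi> x - \<phi> y" for x y
    using add[of "x - y" y] by (simp add: algebra_simps)
  have "\<exists>!s. s \<in> \<phi> ` S \<and> z - s \<in> \<phi> ` T" for z
  proof -
    obtain x where x: "z = \<phi> x" using \<open>bij \<phi>\<close> by (metis bij_pointE)
    obtain s where s: "s \<in> S" "x - s \<in> T" "\<And>s'. s' \<in> S \<Longrightarrow> x - s' \<in> T \<Longrightarrow> s' = s"
      using S[of x] by blast
    show ?thesis
    proof (rule ex1I)
      show "\<phi> s \<in> \<phi> ` S \<and> z - \<phi> s \<in> \<phi> ` T"
        using s(1,2) by (auto simp: x simp flip: diff)
      fix s' assume "s' \<in> \<phi> ` S \<and> z - s' \<in> \<phi> ` T"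
      then obtain r where "s' = \<phi> r" "r \<in> S" "x - r \<in> T"
        by (auto simp: x inj simp flip: diff)
      then show "s' = \<phi> s" using s(3)[of r] by simp
    qed
  qed
  then show ?thesis unfolding tiles_def by blast
qed

text \<open>Modelled on the logarithm of the number of patterns on \<open>F\<close>;
  \<open>translation\<close> is where shift invariance enters.\<close>

locale subadditive_set_function =
  fixes c :: "'g::ab_group_add set \<Rightarrow> real"
  assumes nonneg: "\<And>F. finite F \<Longrightarrow> 0 \<le> c F"
    and mono: "\<And>F G. finite G \<Longrightarrow> F \<subseteq> G \<Longrightarrow> c F \<le> c G"
    and subadditive: "\<And>F G. finite F \<Longrightarrow> finite G \<Longrightarrow> c (F \<union> G) \<le> c F + c G"
    and empty: "c {} = 0"
    and translation: "\<And>F t. finite F \<Longrightarrow> c ((+) t ` F) = c F"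
begin

lemma subadditive_UN:
  assumes "finite S" "\<And>s. s \<in> S \<Longrightarrow> finite (A s)"
  shows "c (\<Union>s\<in>S. A s) \<le> (\<Sum>s\<in>S. c (A s))"
  using assms
proof (induction S rule: finite_induct)
  case (insert s S)
  have "c (\<Union>s\<in>insert s S. A s) \<le> c (A s) + c (\<Union>s\<in>S. A s)"
    using insert by (simp add: subadditive)
  then show ?case using insert by fastforce
qed (simp add: empty)

text \<open>The translates of \<open>T\<close> that meet \<open>F n\<close> cover it, are disjoint
  and lie in (T - T) + F n. So there are at most |(T - T) + F n| / |T| of them, and by the Folner
  property this bound is asymptotic to |F n| / |T|.\<close>

lemma folner_eventually_le:
  assumes "folner F" "tiles T" "finite T" "T \<noteq> {}" "\<epsilon> > 0"
  shows "\<forall>\<^sub>F n in sequentially. c (F n) / real (card (F n)) \<le> c T / real (card T) + \<epsilon>"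
proof -
  obtain S where S: "\<And>z. \<exists>!s. s \<in> S \<and> z - s \<in> T"
    using assms(2) unfolding tiles_def by metis
  define E where "E = (\<lambda>(a, b). a - b) ` (T \<times> T)"
  have E: "finite E" "E \<noteq> {}" using assms by (auto simp: E_def)
  have F: "finite (F n)" "F n \<noteq> {}" for n using assms by (auto simp: folner_def)
  have pos: "card T > 0" using assms by (simp add: card_gt_0_iff)
  let ?q = "\<lambda>n. real (card (E + F n)) / real (card (F n))"
  have "c (F n) / real (card (F n)) \<le> ?q n * (c T / real (card T))" for n
  proof -
    define S' where "S' = {s \<in> S. (+) s ` T \<inter> F n \<noteq> {}}"
    have "S' \<subseteq> (\<lambda>(a, b). a - b) ` (F n \<times> T)"
    proof
      fix s assume "s \<in> S'"
      then obtain t where "t \<in> T" "s + t \<in> F n" by (auto simp: S'_def)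
      then show "s \<in> (\<lambda>(a, b). a - b) ` (F n \<times> T)"
        by (intro image_eqI[of _ _ "(s + t, t)"]) auto
    qed
    then have fin: "finite S'"
      using F assms(3) by (meson finite_SigmaI finite_imageI finite_subset)
    have cover: "F n \<subseteq> (\<Union>s\<in>S'. (+) s ` T)"
    proof
      fix z assume z: "z \<in> F n"
      obtain s where s: "s \<in> S" "z - s \<in> T" using S[of z] by blast
      then have "z \<in> (+) s ` T" by (intro image_eqI[of _ _ "z - s"]) auto
      with z s show "z \<in> (\<Union>s\<in>S'. (+) s ` T)" by (auto simp: S'_def)
    qed
    have "(\<Union>s\<in>S'. (+) s ` T) \<subseteq> E + F n"
    proof clarify
      fix s t assume "s \<in> S'" "t \<in> T"
      then obtain t' where t': "t' \<in> T" "s + t' \<in> F n" by (auto simp: S'_def)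
      have "t - t' \<in> E"
        unfolding E_def using \<open>t \<in> T\<close> t' by (intro image_eqI[of _ _ "(t, t')"]) auto
      then have "(t - t') + (s + t') \<in> E + F n" using t' by blast
      then show "s + t \<in> E + F n" by (simp add: algebra_simps)
    qed
    then have "card (\<Union>s\<in>S'. (+) s ` T) \<le> card (E + F n)"
      by (intro card_mono finite_set_plus E F)
    moreover have "card (\<Union>s\<in>S'. (+) s ` T) = (\<Sum>s\<in>S'. card ((+) s ` T))"
    proof (rule card_UN_disjoint)
      show "\<forall>i\<in>S'. \<forall>j\<in>S'. i \<noteq> j \<longrightarrow> (+) i ` T \<inter> (+) j ` T = {}"
      proof (intro ballI impI equals0I)
        fix i j z assume *: "i \<in> S'" "j \<in> S'" "i \<noteq> j" "z \<in> (+) i ` T \<inter> (+) j ` T"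
        then obtain s t where "z = i + s" "s \<in> T" "z = j + t" "t \<in> T" by blast
        then have "z - i \<in> T" "z - j \<in> T" by (metis add_diff_cancel_left')+
        then show False using S[of z] * by (auto simp: S'_def)
      qed
    qed (use fin assms in auto)
    ultimately have "card S' * card T \<le> card (E + F n)"
      by (simp add: card_image)
    then have count: "real (card S') \<le> real (card (E + F n)) / real (card T)"
      using pos by (simp add: le_divide_eq flip: of_nat_mult)
    have "c (F n) \<le> c (\<Union>s\<in>S'. (+) s ` T)"
      using fin assms cover by (intro mono) auto
    also have "\<dots> \<le> (\<Sum>s\<in>S'. c ((+) s ` T))"
      using fin assms by (intro subadditive_UN) auto
    also have "\<dots> = real (card S') * c T" using assms by (simp add: translation)
    also have "\<dots> \<le> real (card (E + F n)) / real (card T) * c T"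
      using count assms by (intro mult_right_mono nonneg)
    finally have "c (F n) / real (card (F n)) \<le>
        real (card (E + F n)) / real (card T) * c T / real (card (F n))"
      by (intro divide_right_mono) auto
    then show ?thesis by (simp add: field_simps)
  qed
  moreover have "(\<lambda>n. ?q n * (c T / real (card T))) \<longlonglongrightarrow> 1 * (c T / real (card T))"
    using assms(1) E by (intro tendsto_mult) (auto simp: folner_def)
  then have "\<forall>\<^sub>F n in sequentially. ?q n * (c T / real (card T)) < c T / real (card T) + \<epsilon>"
    using \<open>\<epsilon> > 0\<close> by (intro order_tendstoD) auto
  ultimately show ?thesis
    by (elim eventually_mono) (meson order.strict_implies_order order_trans)
qed

text \<open>The limit is the infimum over the tiles of \<open>G\<close>, which does not involve \<open>F\<close>; with \<open>F = G\<close> this is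
  Fekete's lemma.\<close>

lemma folner_tendsto:
  assumes F: "folner F" "\<And>n. tiles (F n)" and G: "folner G" "\<And>n. tiles (G n)"
  shows "(\<lambda>n. c (F n) / real (card (F n))) \<longlonglongrightarrow> (INF n. c (G n) / real (card (G n)))"
proof -
  let ?a = "\<lambda>n. c (F n) / real (card (F n))" and ?b = "\<lambda>n. c (G n) / real (card (G n))"
  have fin: "finite (F n)" "F n \<noteq> {}" "finite (G n)" "G n \<noteq> {}" for n
    using F G by (auto simp: folner_def)
  have bdd: "bdd_below (range ?b)"
    using nonneg fin by (intro bdd_belowI[of _ 0]) auto
  \<comment> \<open>The roles are exchanged: the single set \<open>F n\<close> serves as the tile
    and \<open>G\<close> as the Folner sequence.\<close>
  have lower: "(INF n. ?b n) \<le> ?a n" for n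
  proof (rule field_le_epsilon)
    fix e :: real assume "e > 0"
    then have "\<forall>\<^sub>F m in sequentially. ?b m \<le> ?a n + e"
      using folner_eventually_le[OF G(1) F(2)] fin by blast
    then obtain m where "?b m \<le> ?a n + e" by (auto simp: eventually_sequentially)
    then show "(INF n. ?b n) \<le> ?a n + e" by (rule cINF_lower2[OF bdd UNIV_I])
  qed
  have upper: "\<forall>\<^sub>F n in sequentially. ?a n < (INF n. ?b n) + e" if "e > 0" for e
  proof -
    have "(INF n. ?b n) < (INF n. ?b n) + e/2" using that by simp
    then have "\<exists>m\<in>UNIV. ?b m < (INF n. ?b n) + e/2"
      by (subst cINF_less_iff[OF UNIV_not_empty bdd, symmetric])
    then obtain m where m: "?b m < (INF n. ?b n) + e/2"
      by blast
    have "\<forall>\<^sub>F n in sequentially. ?a n \<le> ?b m + e/2"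
      using folner_eventually_le[OF F(1) G(2)] fin that by (metis half_gt_zero)
    then show ?thesis by (rule eventually_mono) (use m in linarith)
  qed
  show ?thesis
  proof (rule order_tendstoI)
    fix x assume "x < (INF n. ?b n)"
    then show "\<forall>\<^sub>F n in sequentially. x < ?a n"
      using lower by (meson always_eventually order_less_le_trans)
  next
    fix x assume "(INF n. ?b n) < x"
    then show "\<forall>\<^sub>F n in sequentially. ?a n < x"
      using upper[of "x - (INF n. ?b n)"] by simp
  qed
qed

end

section \<open>Cubes\<close>

lemma mem_cube_iff: "i \<in> cube n \<longleftrightarrow> (\<forall>k. \<bar>i $ k\<bar> \<le> int n)"
  by (simp add: cube_def)

lemma finite_cube: "finite (cube n :: (int ^ 'd) set)"
  and card_cube: "card (cube n :: (int ^ 'd) set) = (2 * n + 1) ^ CARD('d)"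
proof -
  let ?P = "UNIV \<rightarrow>\<^sub>E {- int n..int n} :: ('d \<Rightarrow> int) set"
  have *: "(cube n :: (int ^ 'd) set) = vec_lambda ` ?P"
  proof (intro set_eqI iffI)
    fix i :: "int ^ 'd" assume "i \<in> cube n"
    then show "i \<in> vec_lambda ` ?P"
      by (intro image_eqI[of _ _ "($) i"]) (auto simp: mem_cube_iff abs_le_iff minus_le_iff)
  qed (auto simp: mem_cube_iff PiE_iff abs_le_iff minus_le_iff)
  show "finite (cube n :: (int ^ 'd) set)"
    unfolding * by (intro finite_imageI finite_PiE) auto
  have "inj_on vec_lambda ?P" by (auto simp: inj_on_def vec_lambda_inject)
  then show "card (cube n :: (int ^ 'd) set) = (2 * n + 1) ^ CARD('d)"
    unfolding * by (simp add: card_image card_funcsetE nat_add_distrib nat_mult_distrib)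
qed

lemma zero_in_cube: "0 \<in> cube n"
  by (simp add: mem_cube_iff)

lemma finite_subset_cube:
  assumes "finite (E :: (int ^ 'd) set)"
  obtains n where "E \<subseteq> cube n"
proof
  show "E \<subseteq> cube (nat (\<Sum>i\<in>E. \<Sum>k\<in>UNIV. \<bar>i $ k\<bar>))"
  proof
    fix i assume i: "i \<in> E"
    have "\<bar>i $ k\<bar> \<le> (\<Sum>i\<in>E. \<Sum>k\<in>UNIV. \<bar>i $ k\<bar>)" for k
    proof -
      have "\<bar>i $ k\<bar> \<le> (\<Sum>k\<in>UNIV. \<bar>i $ k\<bar>)"
        by (rule member_le_sum) auto
      also have "\<dots> \<le> (\<Sum>i\<in>E. \<Sum>k\<in>UNIV. \<bar>i $ k\<bar>)"
        by (rule member_le_sum[OF i]) (auto intro: sum_nonneg assms)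
      finally show ?thesis .
    qed
    then show "i \<in> cube (nat (\<Sum>i\<in>E. \<Sum>k\<in>UNIV. \<bar>i $ k\<bar>))"
      by (auto simp: mem_cube_iff sum_nonneg)
  qed
qed

lemma folner_cube: "folner (cube :: nat \<Rightarrow> (int ^ 'd) set)"
  unfolding folner_def
proof (intro conjI allI impI)
  fix n show "finite (cube n :: (int ^ 'd) set)" "(cube n :: (int ^ 'd) set) \<noteq> {}"
    using finite_cube zero_in_cube by auto
next
  fix E :: "(int ^ 'd) set" assume E: "finite E \<and> E \<noteq> {}"
  then obtain k where k: "E \<subseteq> cube k" using finite_subset_cube by blast
  let ?f = "\<lambda>n. ((2 * real (n + k) + 1) / (2 * real n + 1)) ^ CARD('d)"
  have card: "real (card (cube n :: (int ^ 'd) set)) = (2 * real n + 1) ^ CARD('d)" for n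
    by (simp add: card_cube add.commute)
  have pos: "0 < card (cube n :: (int ^ 'd) set)" for n
    by (simp add: card_cube)
  \<comment> \<open>This is the subsequence with even indices of 1/(n+1).\<close>
  have "(\<lambda>n. inverse (2 * real n + 1)) \<longlonglongrightarrow> 0"
    using LIMSEQ_subseq_LIMSEQ[OF LIMSEQ_inverse_real_of_nat, of "(*) 2"]
    by (simp add: strict_mono_def o_def add.commute)
  then have "(\<lambda>n. 1 + 2 * real k * inverse (2 * real n + 1)) \<longlonglongrightarrow> 1 + 2 * real k * 0"
    by (intro tendsto_intros)
  moreover have "1 + 2 * real k * inverse (2 * real n + 1) = (2 * real (n + k) + 1) / (2 * real n + 1)" for n
    by (simp add: field_simps)
  ultimately have "?f \<longlonglongrightarrow> 1 ^ CARD('d)"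
    by (intro tendsto_power) simp
  moreover have "real (card (E + cube n)) / real (card (cube n :: (int ^ 'd) set)) \<le> ?f n" for n
  proof -
    have "E + cube n \<subseteq> cube (n + k)"
    proof
      fix z assume "z \<in> E + cube n"
      then obtain e i where z: "z = e + i" "e \<in> E" "i \<in> cube n" by (auto simp: set_plus_def)
      have "\<bar>z $ j\<bar> \<le> int (n + k)" for j
      proof -
        have "\<bar>e $ j\<bar> \<le> int k" "\<bar>i $ j\<bar> \<le> int n" using z k by (auto simp: mem_cube_iff)
        then show ?thesis unfolding z by simp
      qed
      then show "z \<in> cube (n + k)" by (simp add: mem_cube_iff)
    qed
    then have "card (E + cube n) \<le> card (cube (n + k) :: (int ^ 'd) set)"
      by (intro card_mono finite_cube)
    then have "real (card (E + cube n)) / real (card (cube n :: (int ^ 'd) set)) \<le>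
       real (card (cube (n + k) :: (int ^ 'd) set)) / real (card (cube n :: (int ^ 'd) set))"
      by (intro divide_right_mono) auto
    then show ?thesis by (simp add: card power_divide)
  qed
  moreover have "1 \<le> real (card (E + cube n)) / real (card (cube n :: (int ^ 'd) set))" for n
    using card_le_card_set_plus[of E "cube n"] E pos[of n] finite_cube[where 'd = 'd, of n]
    by (simp add: le_divide_eq)
  ultimately show "(\<lambda>n. real (card (E + cube n)) / real (card (cube n :: (int ^ 'd) set))) \<longlonglongrightarrow> 1"
    unfolding power_one
    by - (rule tendsto_sandwich[OF always_eventually always_eventually tendsto_const, of 1 _ ?f];
      simp only: simp_thms)
qed

text \<open>Adding \<open>n\<close> turns a remainder centred at 0 into an ordinary one between 0
  and 2n, which makes the quotient unique. This yields the tiling by cubes and, in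
  \<open>h_top_strict_mono\<close>, the disjointness of the insertion sites.\<close>

lemma abs_diff_le_iff_div:
  fixes z a :: int
  shows "\<bar>z - (2 * int n + 1) * a\<bar> \<le> int n \<longleftrightarrow> a = (z + int n) div (2 * int n + 1)"
proof
  assume "\<bar>z - (2 * int n + 1) * a\<bar> \<le> int n"
  then have "z + int n = (2 * int n + 1) * a + (z + int n - (2 * int n + 1) * a)"
    "0 \<le> z + int n - (2 * int n + 1) * a" "z + int n - (2 * int n + 1) * a < 2 * int n + 1" by auto
  then show "a = (z + int n) div (2 * int n + 1)"
    by (metis int_div_pos_eq)
next
  assume a: "a = (z + int n) div (2 * int n + 1)"
  have "z + int n - (2 * int n + 1) * a = (z + int n) mod (2 * int n + 1)"
    unfolding a by (rule minus_mult_div_eq_mod)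
  moreover have "0 \<le> (z + int n) mod (2 * int n + 1)" "(z + int n) mod (2 * int n + 1) < 2 * int n + 1"
    by (rule pos_mod_sign pos_mod_bound; simp)+
  ultimately show "\<bar>z - (2 * int n + 1) * a\<bar> \<le> int n" by linarith
qed

lemma tiles_cube: "tiles (cube n :: (int ^ 'd) set)"
  unfolding tiles_def
proof (intro exI allI)
  fix z :: "int ^ 'd"
  have *: "z - (2 * int n + 1) *s a \<in> cube n \<longleftrightarrow> a = (\<chi> k. (z $ k + int n) div (2 * int n + 1))" for a
    by (simp only: mem_cube_iff vec_eq_iff vector_minus_component vector_smult_component
        abs_diff_le_iff_div vec_lambda_beta)
  show "\<exists>!s. s \<in> range (\<lambda>a. (2 * int n + 1) *s a) \<and> z - s \<in> cube n"
  proof (rule ex1I)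
    show "(2 * int n + 1) *s (\<chi> k. (z $ k + int n) div (2 * int n + 1)) \<in> range (\<lambda>a. (2 * int n + 1) *s a) \<and>
      z - (2 * int n + 1) *s (\<chi> k. (z $ k + int n) div (2 * int n + 1)) \<in> cube n"
      unfolding * by blast
    fix s assume s: "s \<in> range (\<lambda>a. (2 * int n + 1) *s a) \<and> z - s \<in> cube n"
    then obtain a where "s = (2 * int n + 1) *s a" by blast
    with s show "s = (2 * int n + 1) *s (\<chi> k. (z $ k + int n) div (2 * int n + 1))"
      unfolding * by (simp only: *)
  qed
qed

section \<open>Entropy of shift-invariant sets\<close>

text \<open>The entropy lemmas are stated for this half of \<open>is_shift\<close>, which is what
  gets verified for projections and their powers.\<close>

definition shift_invariant :: "(int ^ 'd \<Rightarrow> 'a) set \<Rightarrow> bool" where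
  "shift_invariant X \<longleftrightarrow> (\<forall>i. shift_map i ` X = X)"

lemma shift_invariantI:
  assumes "\<And>i x. x \<in> X \<Longrightarrow> shift_map i x \<in> X"
  shows "shift_invariant X"
  unfolding shift_invariant_def
proof (intro allI equalityI subsetI)
  fix i x assume "x \<in> X"
  then have "shift_map (- i) x \<in> X" by (rule assms)
  moreover have "x = shift_map i (shift_map (- i) x)" by (simp add: shift_map_def)
  ultimately show "x \<in> shift_map i ` X" by blast
qed (use assms in auto)

lemma shift_map_in: "shift_invariant X \<Longrightarrow> x \<in> X \<Longrightarrow> shift_map i x \<in> X"
  by (auto simp: shift_invariant_def)

lemma finite_patterns:
  fixes X :: "(int ^ 'd \<Rightarrow> 'a::finite) set"
  assumes "finite F"
  shows "finite (patterns F X)"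
proof -
  have "patterns F X \<subseteq> F \<rightarrow>\<^sub>E UNIV" by (auto simp: patterns_def)
  then show ?thesis by (rule finite_subset) (simp add: assms finite_PiE)
qed

lemma card_patterns_pos:
  fixes X :: "(int ^ 'd \<Rightarrow> 'a::finite) set"
  assumes "finite F" "X \<noteq> {}"
  shows "0 < card (patterns F X)"
  using finite_patterns[OF assms(1), of X] assms(2) by (auto simp: card_gt_0_iff patterns_def)

lemma card_patterns_mono:
  fixes X :: "(int ^ 'd \<Rightarrow> 'a::finite) set"
  assumes "finite G" "F \<subseteq> G"
  shows "card (patterns F X) \<le> card (patterns G X)"
proof -
  have "patterns F X = (\<lambda>p. restrict p F) ` patterns G X"
    using assms(2) by (simp add: patterns_def image_image Int_absorb1)
  then show ?thesis using assms(1) by (simp add: card_image_le finite_patterns)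
qed

lemma card_patterns_Un:
  fixes X :: "(int ^ 'd \<Rightarrow> 'a::finite) set"
  assumes "finite F" "finite G"
  shows "card (patterns (F \<union> G) X) \<le> card (patterns F X) * card (patterns G X)"
proof -
  let ?f = "\<lambda>p. (restrict p F, restrict p G)"
  have "inj_on ?f (patterns (F \<union> G) X)"
  proof (rule inj_onI)
    fix p q assume pq: "p \<in> patterns (F \<union> G) X" "q \<in> patterns (F \<union> G) X" "?f p = ?f q"
    show "p = q"
    proof
      fix i
      have "restrict p F i = restrict q F i" "restrict p G i = restrict q G i"
        using pq(3) by simp_all
      moreover have "i \<notin> F \<union> G \<Longrightarrow> p i = undefined \<and> q i = undefined"
        using pq(1,2) by (auto simp: patterns_def)
      ultimately show "p i = q i" by (auto simp: restrict_def split: if_splits)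
    qed
  qed
  moreover have "?f ` patterns (F \<union> G) X \<subseteq> patterns F X \<times> patterns G X"
    by (auto simp: patterns_def Int_absorb1)
  ultimately have "card (patterns (F \<union> G) X) \<le> card (patterns F X \<times> patterns G X)"
    using assms by (intro card_inj_on_le finite_cartesian_product finite_patterns)
  then show ?thesis by (simp add: card_cartesian_product)
qed

lemma card_patterns_translate:
  fixes X :: "(int ^ 'd \<Rightarrow> 'a::finite) set"
  assumes "shift_invariant X" "finite F"
  shows "card (patterns ((+) t ` F) X) = card (patterns F X)"
proof -
  have le: "card (patterns F X) \<le> card (patterns ((+) t ` F) X)" if "finite F" for F t
  proof -
    have "(\<lambda>q. \<lambda>j\<in>F. q (t + j)) ` patterns ((+) t ` F) X = patterns F (shift_map t ` X)"
      unfolding patterns_def image_image by (intro image_cong) (auto simp: shift_map_def)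
    then have "patterns F X = (\<lambda>q. \<lambda>j\<in>F. q (t + j)) ` patterns ((+) t ` F) X"
      using assms(1) by (simp add: shift_invariant_def)
    then show ?thesis using that by (simp add: card_image_le finite_patterns)
  qed
  have "(+) (- t) ` (+) t ` F = F" by (simp add: image_image)
  then show ?thesis using le[OF assms(2), of t] le[of "(+) t ` F" "- t"] assms(2) by simp
qed

lemma subadditive_set_function_patterns:
  fixes X :: "(int ^ 'd \<Rightarrow> 'a::finite) set"
  assumes "shift_invariant X" "X \<noteq> {}"
  shows "subadditive_set_function (\<lambda>F. ln (real (card (patterns F X))))"
proof
  note pos = card_patterns_pos[OF _ assms(2)]
  fix F G :: "(int ^ 'd) set" and t :: "int ^ 'd"
  show "0 \<le> ln (real (card (patterns F X)))" if "finite F"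
    using pos[OF that] by simp
  show "ln (real (card (patterns F X))) \<le> ln (real (card (patterns G X)))" if "finite G" "F \<subseteq> G"
    using card_patterns_mono[OF that, of X] pos[of F] that by (simp add: finite_subset)
  show "ln (real (card (patterns (F \<union> G) X))) \<le>
      ln (real (card (patterns F X))) + ln (real (card (patterns G X)))" if "finite F" "finite G"
  proof -
    have "ln (real (card (patterns (F \<union> G) X))) \<le> ln (real (card (patterns F X) * card (patterns G X)))"
      using card_patterns_Un[OF that, of X] pos[of "F \<union> G"] that
      by (subst ln_le_cancel_iff) (use of_nat_le_iff in \<open>fastforce+\<close>)
    then show ?thesis using pos[of F] pos[of G] that by (simp add: ln_mult)
  qed
  \<comment> \<open>A nonempty \<open>X\<close> has exactly one pattern on the empty set, and ln 1 =
    0.\<close>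
  have "patterns {} X = {\<lambda>_. undefined}"
    using assms(2) by (simp add: patterns_def restrict_def image_constant_conv)
  then show "ln (real (card (patterns {} X))) = 0" by simp
  show "ln (real (card (patterns ((+) t ` F) X))) = ln (real (card (patterns F X)))" if "finite F"
    using card_patterns_translate[OF assms(1) that] by simp
qed

text \<open>The limits along \<open>F\<close> and along cubes are both the infimum over cubes. With
  \<open>F = cube\<close> this also shows that the \<open>lim\<close> in \<open>h_top\<close> is a
  genuine limit.\<close>

lemma h_top_folner:
  fixes X :: "(int ^ 'd \<Rightarrow> 'a::finite) set"
  assumes "shift_invariant X" "X \<noteq> {}" "folner F" "\<And>n. tiles (F n)"
  shows "(\<lambda>n. ln (real (card (patterns (F n) X))) / real (card (F n))) \<longlonglongrightarrow> h_top X"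
proof -
  interpret subadditive_set_function "\<lambda>F. ln (real (card (patterns F X)))"
    using assms by (intro subadditive_set_function_patterns)
  have "h_top X = (INF n. ln (real (card (patterns (cube n) X))) / real (card (cube n :: (int ^ 'd) set)))"
    unfolding h_top_def by (intro limI folner_tendsto folner_cube tiles_cube)
  then show ?thesis using folner_tendsto[OF assms(3,4) folner_cube tiles_cube] by simp
qed

lemma h_top_empty: "h_top {} = 0"
  by (simp add: h_top_def patterns_def)

section \<open>Entropy minimality\<close>

text \<open>Filling specialised to cubes centred at \<open>t\<close>: the pattern that
  \<open>y\<close> shows around the origin is written around \<open>t\<close> into \<open>z\<close>.
  One \<open>l\<close> serves all \<open>k\<close> and \<open>t\<close>.\<close>

lemma uniform_filling_cube:
  fixes Y :: "(int ^ 'd \<Rightarrow> 'a::finite) set"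
  assumes "shift_invariant Y" "uniform_filling Y"
  obtains l where "\<And>k t y z. y \<in> Y \<Longrightarrow> z \<in> Y \<Longrightarrow>
    \<exists>x\<in>Y. (\<forall>i\<in>cube k. x (t + i) = y i) \<and> (\<forall>j. j - t \<notin> cube (k + l) \<longrightarrow> x j = z j)"
proof -
  obtain l :: nat where l: "\<And>y u v P. y \<in> Y \<Longrightarrow> P \<in> patterns {u..v} Y \<Longrightarrow> \<exists>x\<in>Y.
        restrict x {u..v} = P \<and>
        restrict x (- {u - int l *s 1 .. v + int l *s 1})
          = restrict y (- {u - int l *s 1 .. v + int l *s 1})"
    using assms(2) unfolding uniform_filling_def by blast
  have block: "j \<in> {t - int k *s 1 - int m *s 1 .. t + int k *s 1 + int m *s 1} \<longleftrightarrow> j - t \<in> cube (k + m)"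
    for j t :: "int ^ 'd" and k m :: nat
    by (simp add: less_eq_vec_def mem_cube_iff) (smt (verit))
  have block0: "j \<in> {t - int k *s 1 .. t + int k *s 1} \<longleftrightarrow> j - t \<in> cube k" for j t :: "int ^ 'd" and k
    using block[of j t k 0] by simp
  show thesis
  proof
    fix k t y z assume y: "y \<in> Y" and z: "z \<in> Y"
    let ?y = "shift_map (- t) y" and ?u = "t - int k *s 1" and ?v = "t + int k *s 1"
    have "restrict ?y {?u..?v} \<in> patterns {?u..?v} Y"
      using shift_map_in[OF assms(1) y] by (auto simp: patterns_def)
    from l[OF z this] obtain x where x: "x \<in> Y" "restrict x {?u..?v} = restrict ?y {?u..?v}"
      "restrict x (- {?u - int l *s 1 .. ?v + int l *s 1}) = restrict z (- {?u - int l *s 1 .. ?v + int l *s 1})"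
      by blast
    have "x (t + i) = y i" if "i \<in> cube k" for i
    proof -
      have "t + i \<in> {?u..?v}" unfolding block0 using that by simp
      then have "x (t + i) = ?y (t + i)" using fun_cong[OF x(2), of "t + i"] by (simp only: restrict_apply')
      then show ?thesis by (simp add: shift_map_def)
    qed
    moreover have "x j = z j" if "j - t \<notin> cube (k + l)" for j
    proof -
      have "j \<in> - {?u - int l *s 1 .. ?v + int l *s 1}" unfolding Compl_iff block using that .
      then show ?thesis using fun_cong[OF x(3), of j] by (simp only: restrict_apply')
    qed
    ultimately show "\<exists>x\<in>Y. (\<forall>i\<in>cube k. x (t + i) = y i) \<and> (\<forall>j. j - t \<notin> cube (k + l) \<longrightarrow> x j = z j)"
      using x(1) by blast
  qed
qed

text \<open>Only values on the translates \<open>t + cube k\<close> are examined. In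
  \<open>card_avoiding\<close> these lie in the window \<open>W\<close>, so the default value of
  \<open>restrict\<close> is never compared with \<open>y\<close>.\<close>

definition avoiding :: "nat \<Rightarrow> (int ^ 'd \<Rightarrow> 'a) \<Rightarrow> (int ^ 'd) set \<Rightarrow> (int ^ 'd \<Rightarrow> 'a) set" where
  "avoiding k y T = {p. \<forall>t\<in>T. \<exists>i\<in>cube k. p (t + i) \<noteq> y i}"

text \<open>Positions are forbidden one at a time. Overwriting at \<open>t\<close> maps the patterns
  avoiding \<open>T\<close> to those avoiding \<open>T\<close> but not \<open>t\<close>. It changes
  nothing outside \<open>?C\<close>, so it is at most \<open>?a\<close>-to-one. Hence at least a
  fraction 1/\<open>?a\<close> of the patterns in \<open>?Q\<close> is lost by forbidding
  \<open>t\<close>.\<close>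

lemma card_avoiding:
  fixes Y :: "(int ^ 'd \<Rightarrow> 'a::finite) set" and T W :: "(int ^ 'd) set"
  assumes fill: "\<And>t z. z \<in> Y \<Longrightarrow>
      \<exists>x\<in>Y. (\<forall>i\<in>cube k. x (t + i) = y i) \<and> (\<forall>j. j - t \<notin> cube (k + l) \<longrightarrow> x j = z j)"
    and "finite W" "finite T"
    and "\<And>t i. t \<in> T \<Longrightarrow> i \<in> cube k \<Longrightarrow> t + i \<in> W"
    and "\<And>s t j. s \<in> T \<Longrightarrow> t \<in> T \<Longrightarrow> j - s \<in> cube (k + l) \<Longrightarrow> j - t \<in> cube (k + l) \<Longrightarrow> s = t"
  shows "real (card (patterns W Y \<inter> avoiding k y T)) \<le>
    (1 - 1 / real (CARD('a) ^ card (cube (k + l) :: (int ^ 'd) set))) ^ card T * real (card (patterns W Y))"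
  using assms(3-)
proof (induction T rule: finite_induct)
  case empty
  then show ?case by (simp add: card_mono finite_patterns assms(2))
next
  case (insert t T)
  let ?C = "(+) t ` cube (k + l)" and ?a = "real (CARD('a) ^ card (cube (k + l) :: (int ^ 'd) set))"
  let ?Q = "patterns W Y \<inter> avoiding k y T" and ?Q' = "patterns W Y \<inter> avoiding k y (insert t T)"
  have k_subset: "i \<in> cube (k + l)" if "i \<in> cube k" for i :: "int ^ 'd"
    using that unfolding mem_cube_iff by (meson le_add1 of_nat_mono order_trans)
  have finQ: "finite ?Q" using assms(2) by (simp add: finite_patterns)
  have sub: "?Q' \<subseteq> ?Q" by (auto simp: avoiding_def)
  have a: "1 \<le> ?a" by (metis of_nat_1 of_nat_le_iff one_le_power One_nat_def Suc_leI zero_less_card_finite)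
  have "\<forall>p\<in>?Q. \<exists>q\<in>?Q - ?Q'. \<forall>j. j \<notin> ?C \<longrightarrow> q j = p j"
  proof
    fix p assume p: "p \<in> ?Q"
    then obtain z where z: "z \<in> Y" "p = restrict z W" by (auto simp: patterns_def)
    from fill[OF z(1)] obtain x where x: "x \<in> Y" "\<And>i. i \<in> cube k \<Longrightarrow> x (t + i) = y i"
      "\<And>j. j - t \<notin> cube (k + l) \<Longrightarrow> x j = z j" by blast
    have C: "j \<in> ?C \<longleftrightarrow> j - t \<in> cube (k + l)" for j
      by (auto intro: image_eqI[of _ _ "j - t"])
    have pattern: "restrict x W \<in> patterns W Y" using x(1) by (auto simp: patterns_def)
    have same: "restrict x W j = p j" if "j \<notin> ?C" for j
      using that x(3) unfolding z(2) C by (simp add: restrict_def)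
    have avoids: "restrict x W \<in> avoiding k y T"
      unfolding avoiding_def
    proof clarify
      fix s assume s: "s \<in> T"
      then obtain i where i: "i \<in> cube k" "p (s + i) \<noteq> y i"
        using p by (auto simp: avoiding_def)
      \<comment> \<open>Writing at \<open>t\<close> may disturb all of \<open>?C\<close>, but the
        enlarged cubes are disjoint, so the mismatch already present at \<open>s\<close>
        survives.\<close>
      have "s + i \<notin> ?C"
      proof
        assume "s + i \<in> ?C"
        then have "s = t"
          using insert.prems(2)[OF insertI2[OF s] insertI1, of "s + i"] k_subset[OF i(1)] unfolding C by simp
        then show False using s insert.hyps(2) by blast
      qed
      then have "restrict x W (s + i) \<noteq> y i" using i(2) same[of "s + i"] by metis
      with i(1) show "\<exists>i\<in>cube k. restrict x W (s + i) \<noteq> y i" by blast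
    qed
    have "restrict x W (t + i) = y i" if "i \<in> cube k" for i
      using x(2)[OF that] insert.prems(1)[OF insertI1 that] by simp
    then have "restrict x W \<notin> avoiding k y (insert t T)" by (simp add: avoiding_def)
    with pattern avoids have "restrict x W \<in> ?Q - ?Q'" by blast
    with same show "\<exists>q\<in>?Q - ?Q'. \<forall>j. j \<notin> ?C \<longrightarrow> q j = p j" by blast
  qed
  then obtain g where g: "\<And>p. p \<in> ?Q \<Longrightarrow> g p \<in> ?Q - ?Q'" "\<And>p j. p \<in> ?Q \<Longrightarrow> j \<notin> ?C \<Longrightarrow> g p j = p j"
    by metis
  \<comment> \<open>Outside \<open>?C\<close> the pattern is recovered from \<open>g p\<close>;
    inside, it is recorded in the second component.\<close>
  have "inj_on (\<lambda>p. (g p, restrict p ?C)) ?Q"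
  proof (rule inj_onI)
    fix p q assume pq: "p \<in> ?Q" "q \<in> ?Q" "(g p, restrict p ?C) = (g q, restrict q ?C)"
    show "p = q"
    proof
      fix j
      show "p j = q j"
      proof (cases "j \<in> ?C")
        case True
        have "restrict p ?C = restrict q ?C" using pq(3) by blast
        then have "restrict p ?C j = restrict q ?C j" by (rule fun_cong)
        with True show ?thesis by (simp only: restrict_apply')
      next
        case False
        then show ?thesis using g(2)[OF pq(1) False] g(2)[OF pq(2) False] pq(3) by simp
      qed
    qed
  qed
  moreover have "(\<lambda>p. (g p, restrict p ?C)) ` ?Q \<subseteq> (?Q - ?Q') \<times> (?C \<rightarrow>\<^sub>E UNIV)"
    using g(1) by auto
  moreover have "finite ((?Q - ?Q') \<times> (?C \<rightarrow>\<^sub>E (UNIV :: 'a set)))"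
    using finQ by (intro finite_cartesian_product finite_Diff finite_PiE) (auto simp: finite_cube)
  ultimately have "card ?Q \<le> card ((?Q - ?Q') \<times> (?C \<rightarrow>\<^sub>E (UNIV :: 'a set)))"
    by (rule card_inj_on_le)
  also have "\<dots> = card (?Q - ?Q') * CARD('a) ^ card (cube (k + l) :: (int ^ 'd) set)"
    by (simp add: card_cartesian_product card_funcsetE finite_cube card_image)
  also have "card (?Q - ?Q') = card ?Q - card ?Q'"
    by (rule card_Diff_subset[OF finite_subset[OF sub finQ] sub])
  finally have "real (card ?Q) \<le> real (card ?Q - card ?Q') * ?a"
    by (simp only: of_nat_mult[symmetric] of_nat_le_iff)
  also have "real (card ?Q - card ?Q') = real (card ?Q) - real (card ?Q')"
    using card_mono[OF finQ sub] by (rule of_nat_diff)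
  finally have "real (card ?Q) / ?a \<le> real (card ?Q) - real (card ?Q')"
    using a by (simp add: pos_divide_le_eq del: of_nat_power)
  then have "real (card ?Q') \<le> (1 - 1 / ?a) * real (card ?Q)"
    by (simp add: left_diff_distrib)
  also have "\<dots> \<le> (1 - 1 / ?a) * ((1 - 1 / ?a) ^ card T * real (card (patterns W Y)))"
    using insert.IH insert.prems a by (intro mult_left_mono) (simp_all del: of_nat_power)
  finally show ?case using insert.hyps by (simp add: mult.assoc)
qed

text \<open>The open complement of \<open>X\<close> contains a basic product neighbourhood of
  \<open>y\<close>. It constrains finitely many coordinates, and some cube contains them
  all.\<close>

lemma closed_finite_window:
  fixes X :: "(int ^ 'd \<Rightarrow> 'a::finite) set"
  assumes "closedin (product_topology (\<lambda>_. discrete_topology UNIV) UNIV) X" "y \<notin> X"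
  obtains k where "\<And>x. x \<in> X \<Longrightarrow> \<exists>i\<in>cube k. x i \<noteq> y i"
proof -
  have "openin (product_topology (\<lambda>_. discrete_topology UNIV) UNIV) (- X)"
    using assms(1) by (simp add: closedin_def Compl_eq_Diff_UNIV)
  then obtain U :: "int ^ 'd \<Rightarrow> 'a set" where U: "finite {i. U i \<noteq> UNIV}" "y \<in> Pi\<^sub>E UNIV U" "Pi\<^sub>E UNIV U \<subseteq> - X"
    using assms(2) unfolding openin_product_topology_alt by fastforce
  obtain k where k: "{i. U i \<noteq> UNIV} \<subseteq> cube k" using finite_subset_cube[OF U(1)] .
  show thesis
  proof
    fix x assume "x \<in> X"
    then have "x \<notin> Pi\<^sub>E UNIV U" using U(3) by auto
    then obtain i where i: "x i \<notin> U i" by auto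
    then have "i \<in> cube k" using k by auto
    moreover have "y i \<in> U i" using U(2) by auto
    ultimately show "\<exists>i\<in>cube k. x i \<noteq> y i" using i by metis
  qed
qed

text \<open>The cube of radius \<open>(2K+1)q + K\<close> is exactly tiled by the \<open>(2q+1)\<^sup>d\<close> translates of \<open>cube K\<close> used here, in
  each of which the pattern \<open>y|\<^bsub>cube k\<^esub>\<close> missing from \<open>X\<close> could be inserted.\<close>

theorem h_top_strict_mono:
  fixes X Y :: "(int ^ 'd \<Rightarrow> 'a::finite) set"
  assumes "is_shift X" "X \<noteq> {}" "shift_invariant Y" "uniform_filling Y" "X \<subset> Y"
  shows "h_top X < h_top Y"
proof -
  have inv: "shift_invariant X" using assms(1) by (simp add: is_shift_def shift_invariant_def)
  obtain y where y: "y \<in> Y" "y \<notin> X" using assms(5) by auto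
  obtain k where k: "\<And>x. x \<in> X \<Longrightarrow> \<exists>i\<in>cube k. x i \<noteq> y i"
    using closed_finite_window[of X y] assms(1) y(2) by (auto simp: is_shift_def)
  obtain l where l: "\<And>t z. z \<in> Y \<Longrightarrow>
      \<exists>x\<in>Y. (\<forall>i\<in>cube k. x (t + i) = y i) \<and> (\<forall>j. j - t \<notin> cube (k + l) \<longrightarrow> x j = z j)"
    using uniform_filling_cube[OF assms(3,4)] y(1) by metis
  \<comment> \<open>The spacing must separate whole filling zones, of radius \<open>k + l\<close>,
    and not merely the inserted patterns of radius \<open>k\<close>.\<close>
  define K where "K = k + l"
  define r where "r = 1 - 1 / real (CARD('a) ^ card (cube K :: (int ^ 'd) set))"
  define n where "n q = (2 * K + 1) * q + K" for q
  let ?N = "\<lambda>X q. real (card (patterns (cube (n q) :: (int ^ 'd) set) X))"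
  let ?c = "\<lambda>q. real (card (cube q :: (int ^ 'd) set))"
  have posX: "0 < ?N X q" and posY: "0 < ?N Y q" for q
    unfolding of_nat_0_less_iff using assms(2,5) by (intro card_patterns_pos finite_cube; blast)+
  have bound: "?N X q \<le> r ^ card (cube q :: (int ^ 'd) set) * ?N Y q" for q
  proof -
    let ?T = "(\<lambda>i. (2 * int K + 1) *s i) ` (cube q :: (int ^ 'd) set)"
    have inj: "inj_on (\<lambda>i. (2 * int K + 1) *s i) (cube q :: (int ^ 'd) set)"
    proof (rule inj_onI)
      fix s t :: "int ^ 'd" assume "(2 * int K + 1) *s s = (2 * int K + 1) *s t"
      then have "(2 * int K + 1) * s $ m = (2 * int K + 1) * t $ m" for m
        by (metis vector_smult_component)
      moreover have "2 * int K + 1 \<noteq> 0" by presburger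
      ultimately show "s = t" unfolding mult_cancel_left vec_eq_iff by blast
    qed
    have inside: "t + i \<in> cube (n q)" if "t \<in> ?T" "i \<in> cube k" for t i
    proof -
      obtain s where s: "t = (2 * int K + 1) *s s" "s \<in> cube q" using \<open>t \<in> ?T\<close> by blast
      have "\<bar>(t + i) $ m\<bar> \<le> int (n q)" for m
      proof -
        have "\<bar>(2 * int K + 1) * s $ m\<bar> \<le> (2 * int K + 1) * int q"
          using s(2) by (simp add: abs_mult mem_cube_iff mult_left_mono)
        moreover have "\<bar>i $ m\<bar> \<le> int K" using that(2) unfolding mem_cube_iff K_def
          by (meson le_add1 of_nat_mono order_trans)
        ultimately show ?thesis unfolding s(1) n_def vector_add_component vector_smult_component
          by (simp only: of_nat_add of_nat_mult of_nat_1 of_nat_numeral)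
      qed
      then show ?thesis by (simp add: mem_cube_iff)
    qed
    have disjoint: "s = t" if "s \<in> ?T" "t \<in> ?T" "j - s \<in> cube K" "j - t \<in> cube K" for s t j
    proof -
      obtain s' where s': "s = (2 * int K + 1) *s s'" using \<open>s \<in> ?T\<close> by blast
      obtain t' where t': "t = (2 * int K + 1) *s t'" using \<open>t \<in> ?T\<close> by blast
      have "s' $ m = t' $ m" for m
        using that(3,4) unfolding s' t' mem_cube_iff vector_minus_component vector_smult_component
          abs_diff_le_iff_div by metis
      then show ?thesis by (simp add: s' t' vec_eq_iff)
    qed
    have "patterns (cube (n q)) X \<subseteq> patterns (cube (n q)) Y \<inter> avoiding k y ?T"
    proof
      fix p assume "p \<in> patterns (cube (n q)) X"
      then obtain x where x: "x \<in> X" "p = restrict x (cube (n q))" by (auto simp: patterns_def)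
      have "\<exists>i\<in>cube k. p (t + i) \<noteq> y i" if t: "t \<in> ?T" for t
      proof -
        \<comment> \<open>By shift invariance the pattern missing around the origin is missing
          around every \<open>t\<close>.\<close>
        obtain i where i: "i \<in> cube k" "shift_map t x i \<noteq> y i"
          using k[OF shift_map_in[OF inv x(1)]] by blast
        then have "p (t + i) = x (t + i)" unfolding x(2) using inside[OF t i(1)] by (simp only: restrict_apply')
        with i(2) have "p (t + i) \<noteq> y i" by (simp add: shift_map_def)
        with i(1) show ?thesis by blast
      qed
      then show "p \<in> patterns (cube (n q)) Y \<inter> avoiding k y ?T"
        using x assms(5) unfolding patterns_def avoiding_def by blast
    qed
    then have "?N X q \<le> real (card (patterns (cube (n q)) Y \<inter> avoiding k y ?T))"
      by (simp add: card_mono finite_patterns finite_cube)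
    also have "\<dots> \<le> r ^ card ?T * ?N Y q"
      unfolding r_def K_def
    proof (rule card_avoiding[OF l finite_cube])
      show "finite ((\<lambda>i. (2 * int (k + l) + 1) *s i) ` (cube q :: (int ^ 'd) set))"
        by (simp add: finite_cube)
    qed (use inside disjoint in \<open>(unfold K_def; blast)+\<close>)
    finally show ?thesis by (simp only: card_image[OF inj])
  qed
  have c_pos: "0 < ?c q" for q by (simp add: card_cube)
  \<comment> \<open>Needed for \<open>ln r\<close>. If \<open>r\<close> were 0, which happens for a
    one-letter alphabet, the bound at \<open>q = 0\<close> would leave \<open>X\<close> without
    patterns.\<close>
  have r_pos: "0 < r"
  proof (rule ccontr)
    assume "\<not> 0 < r"
    moreover have "0 \<le> r" by (simp add: r_def)
    ultimately have "r = 0" by simp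
    then show False using bound[of 0] posX[of 0] c_pos[of 0] by (simp add: power_0_left)
  qed
  have "r < 1" by (simp add: r_def)
  have c_n: "?c (n q) = ?c K * ?c q" for q
  proof -
    have "2 * n q + 1 = (2 * K + 1) * (2 * q + 1)" by (simp add: n_def algebra_simps)
    then show ?thesis by (simp only: card_cube power_mult_distrib of_nat_mult)
  qed
  \<comment> \<open>There is one insertion site per |cube K| lattice points, so the loss per lattice
    point is \<open>ln r / ?c K\<close>, independent of \<open>q\<close>.\<close>
  have le: "ln (?N X q) / ?c (n q) \<le> ln r / ?c K + ln (?N Y q) / ?c (n q)" for q
  proof -
    have "ln (?N X q) \<le> ln (r ^ card (cube q :: (int ^ 'd) set) * ?N Y q)"
      using bound posX posY r_pos by (subst ln_le_cancel_iff) auto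
    also have "\<dots> = ?c q * ln r + ln (?N Y q)"
      using posY[of q] r_pos by (simp add: ln_mult ln_realpow)
    finally have "ln (?N X q) / ?c (n q) \<le> (?c q * ln r + ln (?N Y q)) / ?c (n q)"
      by (rule divide_right_mono) simp
    also have "\<dots> = ln r / ?c K + ln (?N Y q) / ?c (n q)"
      using c_pos[of q] by (simp add: c_n add_divide_distrib)
    finally show ?thesis .
  qed
  have "strict_mono n" by (auto simp: strict_mono_def n_def intro!: add_less_le_mono)
  have lim: "(\<lambda>q. ln (?N Z q) / ?c (n q)) \<longlonglongrightarrow> h_top Z"
    if "shift_invariant Z" "Z \<noteq> {}" for Z :: "(int ^ 'd \<Rightarrow> 'a) set"
    using LIMSEQ_subseq_LIMSEQ[OF h_top_folner[OF that folner_cube tiles_cube] \<open>strict_mono n\<close>]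
    by (simp add: o_def)
  have "h_top X \<le> ln r / ?c K + h_top Y"
  proof (rule LIMSEQ_le)
    show "(\<lambda>q. ln (?N X q) / ?c (n q)) \<longlonglongrightarrow> h_top X" by (rule lim[OF inv assms(2)])
    show "(\<lambda>q. ln r / ?c K + ln (?N Y q) / ?c (n q)) \<longlonglongrightarrow> ln r / ?c K + h_top Y"
      using y(1) by (intro tendsto_intros lim assms(3)) auto
  qed (use le in blast)
  moreover have "ln r / ?c K < 0"
    using r_pos \<open>r < 1\<close> c_pos[of K] by (simp add: divide_neg_pos)
  ultimately show ?thesis by linarith
qed

section \<open>Powers of projections\<close>

lemma lattice_point_add: "lattice_point u (m + n) = lattice_point u m + lattice_point u n"
  by (simp add: lattice_point_def vec_eq_iff distrib_right sum.distrib)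

text \<open>Bridge between spans, whose sums run over sets of vectors, and coordinates, whose sums
  run over indices.\<close>

lemma sum_range_eq_lattice_point:
  assumes "inj u"
  shows "(\<Sum>x\<in>range u. f x *s x) = lattice_point u (\<chi> i. f (u i))"
  unfolding lattice_point_def using assms by (simp add: sum.reindex)

lemma span_range_eq_lattice_points:
  fixes u :: "'r::finite \<Rightarrow> int ^ 'd"
  assumes "inj u"
  shows "int_vec.span (range u) = range (lattice_point u)"
proof -
  have eq: "lattice_point u m = lattice_point u (\<chi> i. (\<lambda>x. m $ inv u x) (u i))" for m
    using assms by simp
  show ?thesis
    unfolding int_vec.span_finite[OF finite_imageI[OF finite[of UNIV]]] sum_range_eq_lattice_point[OF assms]
    by (intro equalityI image_subsetI rangeI) (rule image_eqI, rule eq, rule UNIV_I)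
qed

lemma inj_lattice_point:
  fixes u :: "'r::finite \<Rightarrow> int ^ 'd"
  assumes "inj u" "int_vec.independent (range u)"
  shows "inj (lattice_point u)"
proof (rule injI)
  fix m n assume eq: "lattice_point u m = lattice_point u n"
  have "lattice_point u (m - n) + lattice_point u n = lattice_point u m"
    by (simp flip: lattice_point_add)
  then have "lattice_point u (m - n) = 0" using eq by simp
  then have "(\<Sum>x\<in>range u. ((m - n) $ inv u x) *s x) = 0"
    by (simp only: sum_range_eq_lattice_point[OF assms(1)] inv_f_f[OF assms(1)] vec_lambda_eta)
  then have "(m - n) $ inv u x = 0" if "x \<in> range u" for x
    using int_vec.independentD[where u = "\<lambda>x. (m - n) $ inv u x", OF assms(2) _ subset_refl] that by simp
  then have "(m - n) $ i = 0" for i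
    using assms(1) by (metis inv_f_f rangeI)
  then show "m = n" by (simp add: vec_eq_iff)
qed

definition sum_point :: "('r::finite \<Rightarrow> int ^ 'd) \<Rightarrow> ('s::finite \<Rightarrow> int ^ 'd) \<Rightarrow> (int ^ 'r) \<times> (int ^ 's) \<Rightarrow> int ^ 'd" where
  "sum_point u v = (\<lambda>(m, w). lattice_point u m + lattice_point v w)"

lemma sum_point_Pair: "sum_point u v (m, w) = lattice_point u m + lattice_point v w"
  by (simp add: sum_point_def)

lemma sum_point_add: "sum_point u v (p + q) = sum_point u v p + sum_point u v q"
  by (simp add: sum_point_def case_prod_unfold lattice_point_add algebra_simps)

text \<open>Splitting sums over \<open>'r + 's\<close> into the two summands turns
  \<open>sum_point\<close> into the coordinate map of the joint basis: spanning gives surjectivity,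
  independence gives injectivity.\<close>

lemma bij_sum_point:
  assumes "complementary_generators u v"
  shows "bij (sum_point u v)"
proof -
  let ?b = "case_sum u v"
  have b: "inj ?b" "int_vec.independent (range ?b)" "int_vec.span (range ?b) = UNIV"
    using assms by (simp_all add: complementary_generators_def)
  have eq: "lattice_point ?b m = sum_point u v (\<chi> i. m $ Inl i, \<chi> i. m $ Inr i)" for m
    by (simp add: lattice_point_def sum_point_def sum.Plus flip: UNIV_Plus_UNIV)
  have eq': "sum_point u v p = lattice_point ?b (\<chi> i. case_sum (($) (fst p)) (($) (snd p)) i)" for p
    by (simp add: eq)
  have "surj (lattice_point ?b)" using b span_range_eq_lattice_points by metis
  then have "surj (sum_point u v)" using eq unfolding surj_def by metis
  moreover have "inj (sum_point u v)"
  proof (rule injI)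
    fix p q assume "sum_point u v p = sum_point u v q"
    then have "(\<chi> i. case_sum (($) (fst p)) (($) (snd p)) i) = (\<chi> i. case_sum (($) (fst q)) (($) (snd q)) i)"
      unfolding eq' by (rule injD[OF inj_lattice_point[OF b(1,2)]])
    then have *: "case_sum (($) (fst p)) (($) (snd p)) i = case_sum (($) (fst q)) (($) (snd q)) i" for i
      by (simp add: vec_eq_iff)
    have "fst p $ i = fst q $ i" for i using *[of "Inl i"] by simp
    moreover have "snd p $ i = snd q $ i" for i using *[of "Inr i"] by simp
    ultimately show "p = q" by (simp add: prod_eq_iff vec_eq_iff)
  qed
  ultimately show ?thesis by (simp add: bij_def)
qed

lemma complementary_generators_inj:
  assumes "complementary_generators u v"
  shows "inj u" "inj v"
proof -
  have "inj (case_sum u v)" using assms by (simp add: complementary_generators_def)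
  then show "inj u" "inj v"
    by (auto simp: inj_def) (metis old.sum.simps sum.inject)+
qed

lemma projection_shift_eq:
  assumes "inj u"
  shows "projection_shift u X = (\<lambda>x m. x (lattice_point u m)) ` X"
  by (simp add: projection_shift_def patterns_def image_image span_range_eq_lattice_points[OF assms])

lemma shift_invariant_projection_shift:
  assumes "shift_invariant X" "inj u"
  shows "shift_invariant (projection_shift u X)"
proof (rule shift_invariantI)
  fix i z assume "z \<in> projection_shift u X"
  then obtain x where x: "x \<in> X" "z = (\<lambda>m. x (lattice_point u m))"
    by (auto simp: projection_shift_eq[OF assms(2)])
  have "shift_map i z = (\<lambda>m. shift_map (lattice_point u i) x (lattice_point u m))"
    by (simp add: shift_map_def x(2) lattice_point_add)
  then show "shift_map i z \<in> projection_shift u X"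
    using shift_map_in[OF assms(1) x(1)] by (auto simp: projection_shift_eq[OF assms(2)])
qed

section \<open>Configurations whose slices along the cosets of L are chosen independently\<close>

definition fibre_power ::
  "((int ^ 'r) \<times> (int ^ 's) \<Rightarrow> int ^ 'd) \<Rightarrow> (int ^ 'r \<Rightarrow> 'a) set \<Rightarrow> (int ^ 'd \<Rightarrow> 'a) set" where
  "fibre_power \<phi> Z = {x. \<forall>w. (\<lambda>m. x (\<phi> (m, w))) \<in> Z}"

lemma lattice_power_eq_fibre_power:
  fixes u :: "'r::finite \<Rightarrow> int ^ 'd" and v :: "'s::finite \<Rightarrow> int ^ 'd"
  assumes "inj u" "inj v"
  shows "lattice_power (int_vec.span (range u)) (int_vec.span (range v)) (patterns (int_vec.span (range u)) X) =
    fibre_power (sum_point u v) (projection_shift u X)"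
proof -
  have "(\<lambda>j\<in>range (lattice_point u). x (j + lattice_point v w)) \<in> patterns (range (lattice_point u)) X \<longleftrightarrow>
     (\<lambda>m. x (sum_point u v (m, w))) \<in> (\<lambda>x m. x (lattice_point u m)) ` X" for x :: "int ^ 'd \<Rightarrow> 'a" and w
  proof
    assume "(\<lambda>j\<in>range (lattice_point u). x (j + lattice_point v w)) \<in> patterns (range (lattice_point u)) X"
    then obtain y where y: "y \<in> X"
      "(\<lambda>j\<in>range (lattice_point u). x (j + lattice_point v w)) = restrict y (range (lattice_point u))"
      by (auto simp: patterns_def)
    have "x (sum_point u v (m, w)) = y (lattice_point u m)" for m
      using fun_cong[OF y(2), of "lattice_point u m"] by (simp add: sum_point_Pair)
    with y(1) show "(\<lambda>m. x (sum_point u v (m, w))) \<in> (\<lambda>x m. x (lattice_point u m)) ` X" by auto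
  next
    assume "(\<lambda>m. x (sum_point u v (m, w))) \<in> (\<lambda>x m. x (lattice_point u m)) ` X"
    then obtain y where y: "y \<in> X" "\<And>m. x (sum_point u v (m, w)) = y (lattice_point u m)"
      by (auto simp: fun_eq_iff)
    then have "(\<lambda>j\<in>range (lattice_point u). x (j + lattice_point v w)) = restrict y (range (lattice_point u))"
      by (auto simp: sum_point_Pair intro!: restrict_ext)
    with y(1) show "(\<lambda>j\<in>range (lattice_point u). x (j + lattice_point v w)) \<in> patterns (range (lattice_point u)) X"
      by (auto simp: patterns_def)
  qed
  then show ?thesis
    unfolding lattice_power_def fibre_power_def projection_shift_eq[OF assms(1)]
      span_range_eq_lattice_points[OF assms(1)] span_range_eq_lattice_points[OF assms(2)]
    by auto
qed

text \<open>Shifting by \<open>\<phi> (a, b)\<close> puts slice \<open>b + w\<close> in the place of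
  slice \<open>w\<close> and shifts it by \<open>a\<close>.\<close>

lemma shift_invariant_fibre_power:
  assumes "shift_invariant Z" "surj \<phi>" and add: "\<And>p q. \<phi> (p + q) = \<phi> p + \<phi> q"
  shows "shift_invariant (fibre_power \<phi> Z)"
proof (rule shift_invariantI)
  fix i x assume x: "x \<in> fibre_power \<phi> Z"
  obtain a b where i: "i = \<phi> (a, b)" using assms(2) by (metis surj_def surj_pair)
  have "(\<lambda>m. shift_map i x (\<phi> (m, w))) = shift_map a (\<lambda>m. x (\<phi> (m, b + w)))" for w
    by (simp add: shift_map_def i flip: add)
  then show "shift_map i x \<in> fibre_power \<phi> Z"
    using x shift_map_in[OF assms(1)] by (auto simp: fibre_power_def)
qed

lemma card_patterns_fibre_power:
  fixes Z :: "(int ^ 'r \<Rightarrow> 'a::finite) set" and \<phi> :: "(int ^ 'r) \<times> (int ^ 's) \<Rightarrow> int ^ 'd"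
  assumes "bij \<phi>" "finite G" "Z \<noteq> {}"
  shows "card (patterns (\<phi> ` (F \<times> G)) (fibre_power \<phi> Z)) = card (patterns F Z) ^ card G"
proof -
  have inj: "\<phi> p = \<phi> q \<longleftrightarrow> p = q" for p q using assms(1) by (auto dest: bij_is_inj injD)
  let ?f = "\<lambda>p. \<lambda>w\<in>G. \<lambda>m\<in>F. p (\<phi> (m, w))"
  have "bij_betw ?f (patterns (\<phi> ` (F \<times> G)) (fibre_power \<phi> Z)) (G \<rightarrow>\<^sub>E patterns F Z)"
    unfolding bij_betw_def
  proof
    show "inj_on ?f (patterns (\<phi> ` (F \<times> G)) (fibre_power \<phi> Z))"
    proof (rule inj_onI)
      fix p q assume p: "p \<in> patterns (\<phi> ` (F \<times> G)) (fibre_power \<phi> Z)"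
        and q: "q \<in> patterns (\<phi> ` (F \<times> G)) (fibre_power \<phi> Z)" and eq: "?f p = ?f q"
      show "p = q"
      proof
        fix j
        show "p j = q j"
        proof (cases "j \<in> \<phi> ` (F \<times> G)")
          case True
          then obtain m w where j: "j = \<phi> (m, w)" "m \<in> F" "w \<in> G" by auto
          then show ?thesis using fun_cong[OF fun_cong[OF eq, of w], of m] by simp
        next
          case False
          then show ?thesis using p q by (auto simp: patterns_def)
        qed
      qed
    qed
    show "?f ` patterns (\<phi> ` (F \<times> G)) (fibre_power \<phi> Z) = G \<rightarrow>\<^sub>E patterns F Z"
    proof (intro equalityI subsetI)
      fix g assume "g \<in> ?f ` patterns (\<phi> ` (F \<times> G)) (fibre_power \<phi> Z)"
      then obtain x where x: "x \<in> fibre_power \<phi> Z" "g = ?f (restrict x (\<phi> ` (F \<times> G)))"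
        by (auto simp: patterns_def)
      have "g = (\<lambda>w\<in>G. restrict (\<lambda>m. x (\<phi> (m, w))) F)"
        unfolding x(2) by (intro restrict_ext) auto
      then show "g \<in> G \<rightarrow>\<^sub>E patterns F Z"
        using x(1) by (auto simp: fibre_power_def patterns_def)
    next
      fix g assume g: "g \<in> G \<rightarrow>\<^sub>E patterns F Z"
      \<comment> \<open>Membership in the power constrains every slice; \<open>z0\<close> fills
        those with \<open>w\<close> outside \<open>G\<close>.\<close>
      obtain z0 where "z0 \<in> Z" using assms(3) by auto
      have "\<forall>w. \<exists>z\<in>Z. w \<in> G \<longrightarrow> g w = restrict z F"
      proof
        fix w show "\<exists>z\<in>Z. w \<in> G \<longrightarrow> g w = restrict z F"
          using g \<open>z0 \<in> Z\<close> by (cases "w \<in> G") (auto simp: patterns_def PiE_iff)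
      qed
      then obtain z where z: "\<And>w. z w \<in> Z" "\<And>w. w \<in> G \<Longrightarrow> g w = restrict (z w) F" by metis
      define x where "x j = z (snd (inv \<phi> j)) (fst (inv \<phi> j))" for j
      have x: "x (\<phi> (m, w)) = z w m" for m w
        by (simp add: x_def bij_is_inj[OF assms(1)])
      have "x \<in> fibre_power \<phi> Z" using z(1) by (simp add: fibre_power_def x)
      moreover have "g = ?f (restrict x (\<phi> ` (F \<times> G)))"
      proof
        fix w show "g w = ?f (restrict x (\<phi> ` (F \<times> G))) w"
        proof (cases "w \<in> G")
          case True
          then have "?f (restrict x (\<phi> ` (F \<times> G))) w = restrict (z w) F"
            by (auto simp: x intro!: restrict_ext)
          then show ?thesis using z(2)[OF True] by simp
        qed (use g in auto)
      qed
      ultimately show "g \<in> ?f ` patterns (\<phi> ` (F \<times> G)) (fibre_power \<phi> Z)"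
        unfolding patterns_def by blast
    qed
  qed
  then show ?thesis by (simp add: bij_betw_same_card card_funcsetE assms(2))
qed

text \<open>The exponent |cube n| contributed by the fibre directions cancels the same factor of |D
  n|. So the quotient for the power along \<open>D\<close> equals the one for \<open>Z\<close> along
  cubes at every \<open>n\<close>, not only in the limit.\<close>

lemma h_top_fibre_power:
  fixes Z :: "(int ^ 'r \<Rightarrow> 'a::finite) set" and \<phi> :: "(int ^ 'r) \<times> (int ^ 's) \<Rightarrow> int ^ 'd"
  assumes "shift_invariant Z" "Z \<noteq> {}" "bij \<phi>" and add: "\<And>p q. \<phi> (p + q) = \<phi> p + \<phi> q"
  shows "h_top (fibre_power \<phi> Z) = h_top Z"
proof -
  let ?Y = "fibre_power \<phi> Z"
  define D where "D n = \<phi> ` (cube n \<times> cube n)" for n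
  have D: "folner D" "\<And>n. tiles (D n)"
    unfolding D_def
    by (intro folner_image tiles_image folner_Times tiles_Times folner_cube tiles_cube assms(3) add)+
  have inv: "shift_invariant ?Y"
    by (rule shift_invariant_fibre_power[OF assms(1) bij_is_surj[OF assms(3)] add])
  have card: "card (patterns (D n) ?Y) = card (patterns (cube n) Z) ^ card (cube n :: (int ^ 's) set)" for n
    unfolding D_def by (rule card_patterns_fibre_power[OF assms(3) finite_cube assms(2)])
  have "?Y \<noteq> {}"
  proof
    assume "?Y = {}"
    moreover have "0 < card (patterns (D 0) ?Y)"
      unfolding card using card_patterns_pos[OF finite_cube assms(2)] by simp
    ultimately show False by (simp add: patterns_def)
  qed
  then have Y: "(\<lambda>n. ln (real (card (patterns (D n) ?Y))) / real (card (D n))) \<longlonglongrightarrow> h_top ?Y"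
    by (intro h_top_folner inv D)
  have eq: "ln (real (card (patterns (D n) ?Y))) / real (card (D n)) =
      ln (real (card (patterns (cube n) Z))) / real (card (cube n :: (int ^ 'r) set))" for n
  proof -
    have "card (D n) = card (cube n :: (int ^ 'r) set) * card (cube n :: (int ^ 's) set)"
      unfolding D_def by (simp add: card_image inj_on_subset[OF bij_is_inj[OF assms(3)]] card_cartesian_product)
    moreover have "0 < card (cube n :: (int ^ 's) set)" by (simp add: card_cube)
    moreover have "0 < real (card (patterns (cube n) Z))"
      using card_patterns_pos[OF finite_cube assms(2)] by simp
    ultimately show ?thesis by (simp add: card ln_realpow)
  qed
  show ?thesis
    using LIMSEQ_unique[OF Y[unfolded eq] h_top_folner[OF assms(1,2) folner_cube tiles_cube]] .
qed

text \<open>Slice \<open>w\<close> of \<open>x\<close> is the slice through the origin of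
  \<open>x\<close> shifted by \<open>lattice_point v w\<close>, again a point of
  \<open>X\<close>.\<close>

lemma subset_fibre_power_projection:
  assumes "shift_invariant X" "inj u"
  shows "X \<subseteq> fibre_power (sum_point u v) (projection_shift u X)"
proof
  fix x assume x: "x \<in> X"
  have "(\<lambda>m. x (sum_point u v (m, w))) = (\<lambda>m. shift_map (lattice_point v w) x (lattice_point u m))" for w
    by (simp add: shift_map_def sum_point_Pair add.commute)
  then show "x \<in> fibre_power (sum_point u v) (projection_shift u X)"
    using shift_map_in[OF assms(1) x] by (auto simp: fibre_power_def projection_shift_eq[OF assms(2)])
qed

text \<open>The filling length of \<open>X\<close> works unchanged: after moving slice
  \<open>w\<close> onto L, the block appears translated by minus \<open>lattice_point v w\<close>,
  and \<open>l\<close> is uniform over all blocks.\<close>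

lemma uniform_filling_fibre_power:
  fixes X :: "(int ^ 'd \<Rightarrow> 'a::finite) set"
  assumes "uniform_filling X" "complementary_generators u v"
  shows "uniform_filling (fibre_power (sum_point u v) (projection_shift u X))"
proof -
  let ?Y = "fibre_power (sum_point u v) (projection_shift u X)"
  note inj_u = complementary_generators_inj(1)[OF assms(2)] and bij = bij_sum_point[OF assms(2)]
  obtain l :: nat where l: "\<And>y u v P. y \<in> X \<Longrightarrow> P \<in> patterns {u..v} X \<Longrightarrow> \<exists>x\<in>X.
        restrict x {u..v} = P \<and>
        restrict x (- {u - int l *s 1 .. v + int l *s 1})
          = restrict y (- {u - int l *s 1 .. v + int l *s 1})"
    using assms(1) unfolding uniform_filling_def by blast
  have slices: "\<forall>w. \<exists>z\<in>X. \<forall>m. y (sum_point u v (m, w)) = z (lattice_point u m)" if "y \<in> ?Y" for y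
    using that unfolding fibre_power_def projection_shift_eq[OF inj_u] by (auto simp: fun_eq_iff image_iff)
  have "\<exists>x\<in>?Y. restrict x {a..b} = P \<and>
        restrict x (- {a - int l *s 1 .. b + int l *s 1}) = restrict y (- {a - int l *s 1 .. b + int l *s 1})"
    if y: "y \<in> ?Y" and P: "P \<in> patterns {a..b} ?Y" for y a b P
  proof -
    obtain z where z: "z \<in> ?Y" "P = restrict z {a..b}" using P by (auto simp: patterns_def)
    obtain \<eta> where \<eta>: "\<And>w. \<eta> w \<in> X" "\<And>w m. y (sum_point u v (m, w)) = \<eta> w (lattice_point u m)"
      using slices[OF y] by metis
    obtain \<zeta> where \<zeta>: "\<And>w. \<zeta> w \<in> X" "\<And>w m. z (sum_point u v (m, w)) = \<zeta> w (lattice_point u m)"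
      using slices[OF z(1)] by metis
    have "\<exists>x\<in>X. (\<forall>j. lattice_point v w + j \<in> {a..b} \<longrightarrow> x j = \<zeta> w j) \<and>
        (\<forall>j. lattice_point v w + j \<notin> {a - int l *s 1 .. b + int l *s 1} \<longrightarrow> x j = \<eta> w j)" for w
    proof -
      let ?s = "lattice_point v w"
      have "restrict (\<zeta> w) {a - ?s..b - ?s} \<in> patterns {a - ?s..b - ?s} X"
        using \<zeta>(1) by (auto simp: patterns_def)
      from l[OF \<eta>(1) this] obtain x where x: "x \<in> X"
        "restrict x {a - ?s..b - ?s} = restrict (\<zeta> w) {a - ?s..b - ?s}"
        "restrict x (- {a - ?s - int l *s 1 .. b - ?s + int l *s 1}) =
          restrict (\<eta> w) (- {a - ?s - int l *s 1 .. b - ?s + int l *s 1})" by blast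
      have block: "j \<in> {a' - ?s..b' - ?s} \<longleftrightarrow> ?s + j \<in> {a'..b'}" for j a' b'
        by (simp add: less_eq_vec_def algebra_simps)
      have big: "{a - ?s - int l *s 1 .. b - ?s + int l *s 1} = {a - int l *s 1 - ?s .. b + int l *s 1 - ?s}"
        by (simp add: algebra_simps)
      have "x j = \<zeta> w j" if "?s + j \<in> {a..b}" for j
        using fun_cong[OF x(2), of j] that unfolding block[symmetric] by (simp only: restrict_apply')
      moreover have "x j = \<eta> w j" if "?s + j \<notin> {a - int l *s 1 .. b + int l *s 1}" for j
        using fun_cong[OF x(3)[unfolded big], of j] that unfolding block[symmetric]
        by (simp only: restrict_apply' Compl_iff not_False_eq_True)
      ultimately show ?thesis using x(1) by blast
    qed
    then obtain \<xi> where \<xi>: "\<And>w. \<xi> w \<in> X"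
      "\<And>w j. lattice_point v w + j \<in> {a..b} \<Longrightarrow> \<xi> w j = \<zeta> w j"
      "\<And>w j. lattice_point v w + j \<notin> {a - int l *s 1 .. b + int l *s 1} \<Longrightarrow> \<xi> w j = \<eta> w j"
      by metis
    \<comment> \<open>Of each \<open>\<xi> w\<close> only the values on L are kept. They are glued
      along the cosets of L, which partition Z^d, so different slices impose no conditions on each
      other.\<close>
    define x where "x j = \<xi> (snd (inv (sum_point u v) j)) (lattice_point u (fst (inv (sum_point u v) j)))" for j
    have x: "x (sum_point u v (m, w)) = \<xi> w (lattice_point u m)" for m w
      by (simp add: x_def bij_is_inj[OF bij])
    have "x \<in> ?Y"
      using \<xi>(1) by (auto simp: fibre_power_def x projection_shift_eq[OF inj_u])
    moreover have "x j = z j" if "j \<in> {a..b}" for j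
    proof -
      obtain m w where j: "j = sum_point u v (m, w)" using bij by (metis bij_pointE surj_pair)
      show ?thesis unfolding j x \<zeta>(2) by (rule \<xi>(2)) (use that in \<open>simp only: j sum_point_Pair add.commute\<close>)
    qed
    then have "restrict x {a..b} = P" unfolding z(2) by (rule restrict_ext)
    moreover have "x j = y j" if "j \<in> - {a - int l *s 1 .. b + int l *s 1}" for j
    proof -
      obtain m w where j: "j = sum_point u v (m, w)" using bij by (metis bij_pointE surj_pair)
      show ?thesis unfolding j x \<eta>(2)
        by (rule \<xi>(3)) (use that in \<open>simp only: j sum_point_Pair add.commute Compl_iff not_False_eq_True\<close>)
    qed
    then have "restrict x (- {a - int l *s 1 .. b + int l *s 1}) = restrict y (- {a - int l *s 1 .. b + int l *s 1})"
      by (rule restrict_ext)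
    ultimately show ?thesis by blast
  qed
  then show ?thesis unfolding uniform_filling_def by blast
qed

theorem theorem2p3:
  fixes X :: "(int ^ 'd \<Rightarrow> 'a::finite) set"
    and u :: "'r::finite \<Rightarrow> int ^ 'd"
    and v :: "'s::finite \<Rightarrow> int ^ 'd"
    and L L' :: "(int ^ 'd) set"
  assumes "is_shift X"
    and "uniform_filling X"
    and "complementary_generators u v"
    and "L = int_vec.span (range u)"
    and "L' = int_vec.span (range v)"
  shows "h_top X = projectional_entropy u X \<longleftrightarrow> X = lattice_power L L' (patterns L X)"
proof -
  let ?Z = "projection_shift u X" and ?Y = "fibre_power (sum_point u v) (projection_shift u X)"
  note inj = complementary_generators_inj[OF assms(3)] and bij = bij_sum_point[OF assms(3)]
  have inv: "shift_invariant X" using assms(1) by (simp add: is_shift_def shift_invariant_def)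
  have Z: "shift_invariant ?Z" by (rule shift_invariant_projection_shift[OF inv inj(1)])
  have "h_top X = h_top ?Z \<longleftrightarrow> X = ?Y"
  proof (cases "X = {}")
    \<comment> \<open>Both sides hold: the two entropies are 0, and the power of the empty
      projection is empty because there is at least one slice.\<close>
    case True
    then have "?Z = {}" by (simp add: projection_shift_eq[OF inj(1)])
    then show ?thesis using True by (simp add: h_top_empty fibre_power_def)
  next
    case False
    then have "?Z \<noteq> {}" by (simp add: projection_shift_eq[OF inj(1)])
    then have "h_top ?Y = h_top ?Z"
      by (rule h_top_fibre_power[OF Z _ bij sum_point_add])
    moreover have "h_top X < h_top ?Y" if "X \<noteq> ?Y"
    proof (rule h_top_strict_mono[OF assms(1) False])
      show "shift_invariant ?Y"
        by (rule shift_invariant_fibre_power[OF Z bij_is_surj[OF bij] sum_point_add])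
      show "uniform_filling ?Y" by (rule uniform_filling_fibre_power[OF assms(2,3)])
      show "X \<subset> ?Y" using subset_fibre_power_projection[OF inv inj(1)] that by blast
    qed
    ultimately show ?thesis by force
  qed
  then show ?thesis
    unfolding projectional_entropy_def assms(4,5) lattice_power_eq_fibre_power[OF inj] .
qed

end
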